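(* Let $\mathbf{L}$ be any logic between $\mathbf{B}$ and $\mathbf{RM}$. Then quantifier elimination fails for RCF (real closed fields) in $\mathbf{L}$: there is a formula $A$ in the language of RCF such that for no quantifier-free formula $B$ in that language do we have $\mathrm{RCF}\vDash_{\mathbf{L}} A\leftrightarrow B$.
   Context: Language: first-order formulas built with $\neg,\land,\lor,\rightarrow,\forall,\exists,\bot,\top$ and the logical predicate $=$. $A\leftrightarrow B$ abbreviates $(A\rightarrow B)\land(B\rightarrow A)$. A $\mathbf{B}$-frame is $\langle W,R,{}^*,s\rangle$ with $W\neq\varnothing$, $R\subseteq W^3$, ${}^*:W\to W$, $s\in W$, such that for all $\alpha,\beta,\gamma,\delta\in W$: $Rs\alpha\alpha$; $Rs\alpha\beta$ and $R\beta\gamma\delta$ imply $R\alpha\gamma\delta$; $\alpha^{**}=\alpha$; $Rs\alpha\beta$ implies $Rs\beta^*\alpha^*$. A $\mathbf{B}$-model $M=\langle W,R,D,{}^*,s,V\rangle$ adds a nonempty set $D$ and a valuation $V$ with $V(w,P)\subseteq D^n$ for each $w\in W$ and $n$-ary predicate $P$, such that $Rs\alpha\beta$ implies $V(\alpha,P)\subseteq V(\beta,P)$; function and constant symbols are interpreted on $D$ independently of worlds; $=$ is interpreted as real identity on $D$ at every world. Truth at a world $w$ under an assignment $\overline{a}$ of elements of $D$ to variables: atomic formulas according to $V(w,\cdot)$; $\top$ always, $\bot$ never; $\land,\lor$ as usual at $w$; $M,w\vDash\neg A[\overline a]$ iff $M,w^*\nvDash A[\overline a]$; $M,w\vDash (A\rightarrow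 B)[\overline a]$ iff for all $w_1,w_2$ with $Rww_1w_2$, $M,w_1\vDash A[\overline a]$ implies $M,w_2\vDash B[\overline a]$; $\forall x$, $\exists x$ range over $D$ at $w$. A formula with free variables holds at $w$ in $M$ (without assignment) if it holds under all assignments. An $\mathbf{RM}$-frame is a $\mathbf{B}$-frame such that for all $\alpha,\beta,\gamma,\delta$: $R\alpha\beta\gamma$ implies $R\alpha\gamma^*\beta^*$; $R\alpha\beta\gamma$ implies $R\beta\alpha\gamma$; $R\alpha\alpha\alpha$; if there is $x$ with $R\alpha\beta x$ and $Rx\gamma\delta$ then there is $y$ with $R\alpha y\delta$ and $R\beta\gamma y$; $R\alpha\beta\gamma$ implies $Rs\alpha\gamma$ or $Rs\beta\gamma$. A logic $\mathbf{L}$ extending $\mathbf{B}$ is given by a class of $\mathbf{B}$-frames ($\mathbf{L}$-frames); $\mathbf{L}$-models are the $\mathbf{B}$-models on $\mathbf{L}$-frames. $\mathbf{L}$ lies between $\mathbf{B}$ and $\mathbf{RM}$ if every $\mathbf{RM}$-frame is an $\mathbf{L}$-frame. $\Gamma\vDash_{\mathbf{L}}A$ means: for every $\mathbf{L}$-model $M$, if $M,s\vDash\Gamma$ then $M,s\vDash A$. RCF, in the signature with binary predicate $<$, binary functions $+,\times$ (with $xy$ for $x\times y$), unary functions $-,{}^{-1}$, constants $0,1$, has the axioms: $\forall x(x<x\rightarrow\bot)$; $\forall x,y(x=y\lor x<y\lor y<x)$; $\forall x,y,z((x<y\land y<z)\rightarrow x<z)$; $\forall x,y((0<x\land 0<y)\rightarrow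 0<xy)$; $\forall x,y,z(x<y\rightarrow x+z<y+z)$; $\forall x\exists y(0<x\rightarrow x=yy)$; $\forall x_1,\dots,x_n\exists y(y^n+x_1y^{n-1}+\dots+x_n=0)$ for each odd $n>0$; $\forall x,y,z((x+y)+z=x+(y+z))$; $\forall x(x+0=x)$; $\forall x(x+(-x)=0)$; $\forall x,y(x+y=y+x)$; $\forall x,y,z((xy)z=x(yz))$; $\forall x(x1=x)$; $\forall x(\neg(x=0)\rightarrow xx^{-1}=1)$; $\forall x,y(xy=yx)$; $\forall x,y,z(x(y+z)=(xy)+(xz))$; $0=1\rightarrow\bot$. A theory $T$ admits quantifier elimination in $\mathbf{L}$ if for every formula $A$ there is a quantifier-free formula $B$ with $T\vDash_{\mathbf{L}}A\leftrightarrow B$. *)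

theory Defs
  imports Main
begin

section \<open>The language of real closed fields\<close>

datatype tm =
    Var nat
  | Zero
  | One
  | Neg tm
  | Inv tm
  | Plus tm tm
  | Times tm tm

datatype fm =
    Eq tm tm
  | Less tm tm
  | Top
  | Bot
  | Not fm
  | And fm fm
  | Or fm fm
  | Imp fm fm
  | All nat fm
  | Ex nat fm

definition Iff :: "fm \<Rightarrow> fm \<Rightarrow> fm" where
  "Iff A B = And (Imp A B) (Imp B A)"

primrec qfree :: "fm \<Rightarrow> bool" where
  "qfree (Eq t u) \<longleftrightarrow> True"
| "qfree (Less t u) \<longleftrightarrow> True"
| "qfree Top \<longleftrightarrow> True"
| "qfree Bot \<longleftrightarrow> True"
| "qfree (Not A) \<longleftrightarrow> qfree A"
| "qfree (And A B) \<longleftrightarrow> qfree A \<and> qfree B"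
| "qfree (Or A B) \<longleftrightarrow> qfree A \<and> qfree B"
| "qfree (Imp A B) \<longleftrightarrow> qfree A \<and> qfree B"
| "qfree (All x A) \<longleftrightarrow> False"
| "qfree (Ex x A) \<longleftrightarrow> False"


section \<open>Frames\<close>

text \<open>Only the values of \<open>star\<close> on \<open>worlds\<close> matter.\<close>

record 'w frame =
  worlds :: "'w set"
  rel :: "('w \<times> 'w \<times> 'w) set"
  star :: "'w \<Rightarrow> 'w"
  base :: 'w

definition B_frame :: "'w frame \<Rightarrow> bool" where
  "B_frame F \<longleftrightarrow>
    (let W = worlds F; R = (\<lambda>a b c. (a, b, c) \<in> rel F); st = star F; s = base F in
      W \<noteq> {} \<and> rel F \<subseteq> W \<times> W \<times> W \<and> (\<forall>a\<in>W. st a \<in> W) \<and> s \<in> W \<and>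
      (\<forall>a\<in>W. R s a a) \<and>
      (\<forall>a\<in>W. \<forall>b\<in>W. \<forall>c\<in>W. \<forall>d\<in>W. R s a b \<and> R b c d \<longrightarrow> R a c d) \<and>
      (\<forall>a\<in>W. st (st a) = a) \<and>
      (\<forall>a\<in>W. \<forall>b\<in>W. R s a b \<longrightarrow> R s (st b) (st a)))"

definition RM_frame :: "'w frame \<Rightarrow> bool" where
  "RM_frame F \<longleftrightarrow> B_frame F \<and>
    (let W = worlds F; R = (\<lambda>a b c. (a, b, c) \<in> rel F); st = star F; s = base F in
      (\<forall>a\<in>W. \<forall>b\<in>W. \<forall>c\<in>W. R a b c \<longrightarrow> R a (st c) (st b)) \<and>
      (\<forall>a\<in>W. \<forall>b\<in>W. \<forall>c\<in>W. R a b c \<longrightarrow> R b a c) \<and>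
      (\<forall>a\<in>W. R a a a) \<and>
      (\<forall>a\<in>W. \<forall>b\<in>W. \<forall>c\<in>W. \<forall>d\<in>W.
        (\<exists>x\<in>W. R a b x \<and> R x c d) \<longrightarrow> (\<exists>y\<in>W. R a y d \<and> R b c y)) \<and>
      (\<forall>a\<in>W. \<forall>b\<in>W. \<forall>c\<in>W. R a b c \<longrightarrow> R s a c \<or> R s b c))"

text \<open>
  A logic extending \<open>B\<close> is a class of \<open>B\<close>-frames.  Classes of frames are rendered as sets of frames
  whose worlds are drawn from a type \<open>'w\<close>.
\<close>

definition logic_between_B_and_RM :: "'w frame set \<Rightarrow> bool" where
  "logic_between_B_and_RM L \<longleftrightarrow>
    (\<forall>F\<in>L. B_frame F) \<and> (\<forall>F. RM_frame F \<longrightarrow> F \<in> L)"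


section \<open>Models and truth\<close>

text \<open>
  \<open>less_at M w\<close> is the valuation of the only non-logical predicate \<open><\<close> at \<open>w\<close>.  The function
  symbols do not depend on worlds; only their values on \<open>domain\<close> matter.
\<close>

record ('w, 'd) model =
  frame_of :: "'w frame"
  domain :: "'d set"
  zero_of :: 'd
  one_of :: 'd
  neg_of :: "'d \<Rightarrow> 'd"
  inv_of :: "'d \<Rightarrow> 'd"
  plus_of :: "'d \<Rightarrow> 'd \<Rightarrow> 'd"
  times_of :: "'d \<Rightarrow> 'd \<Rightarrow> 'd"
  less_at :: "'w \<Rightarrow> ('d \<times> 'd) set"

definition B_model :: "('w, 'd) model \<Rightarrow> bool" where
  "B_model M \<longleftrightarrow>
    (let F = frame_of M; W = worlds F; D = domain M in
      B_frame F \<and> D \<noteq> {} \<and>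
      zero_of M \<in> D \<and> one_of M \<in> D \<and>
      (\<forall>x\<in>D. neg_of M x \<in> D) \<and> (\<forall>x\<in>D. inv_of M x \<in> D) \<and>
      (\<forall>x\<in>D. \<forall>y\<in>D. plus_of M x y \<in> D) \<and> (\<forall>x\<in>D. \<forall>y\<in>D. times_of M x y \<in> D) \<and>
      (\<forall>w\<in>W. less_at M w \<subseteq> D \<times> D) \<and>
      (\<forall>a\<in>W. \<forall>b\<in>W. (base F, a, b) \<in> rel F \<longrightarrow> less_at M a \<subseteq> less_at M b))"

definition L_model :: "'w frame set \<Rightarrow> ('w, 'd) model \<Rightarrow> bool" where
  "L_model L M \<longleftrightarrow> B_model M \<and> frame_of M \<in> L"

primrec tm_val :: "('w, 'd) model \<Rightarrow> (nat \<Rightarrow> 'd) \<Rightarrow> tm \<Rightarrow> 'd" where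
  "tm_val M e (Var x) = e x"
| "tm_val M e Zero = zero_of M"
| "tm_val M e One = one_of M"
| "tm_val M e (Neg t) = neg_of M (tm_val M e t)"
| "tm_val M e (Inv t) = inv_of M (tm_val M e t)"
| "tm_val M e (Plus t u) = plus_of M (tm_val M e t) (tm_val M e u)"
| "tm_val M e (Times t u) = times_of M (tm_val M e t) (tm_val M e u)"

primrec sat :: "('w, 'd) model \<Rightarrow> 'w \<Rightarrow> (nat \<Rightarrow> 'd) \<Rightarrow> fm \<Rightarrow> bool" where
  "sat M w e (Eq t u) \<longleftrightarrow> tm_val M e t = tm_val M e u"
| "sat M w e (Less t u) \<longleftrightarrow> (tm_val M e t, tm_val M e u) \<in> less_at M w"
| "sat M w e Top \<longleftrightarrow> True"
| "sat M w e Bot \<longleftrightarrow> False"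
| "sat M w e (Not A) \<longleftrightarrow> \<not> sat M (star (frame_of M) w) e A"
| "sat M w e (And A B) \<longleftrightarrow> sat M w e A \<and> sat M w e B"
| "sat M w e (Or A B) \<longleftrightarrow> sat M w e A \<or> sat M w e B"
| "sat M w e (Imp A B) \<longleftrightarrow>
    (\<forall>w1 w2. (w, w1, w2) \<in> rel (frame_of M) \<longrightarrow> sat M w1 e A \<longrightarrow> sat M w2 e B)"
| "sat M w e (All x A) \<longleftrightarrow> (\<forall>d\<in>domain M. sat M w (e(x := d)) A)"
| "sat M w e (Ex x A) \<longleftrightarrow> (\<exists>d\<in>domain M. sat M w (e(x := d)) A)"

definition holds :: "('w, 'd) model \<Rightarrow> 'w \<Rightarrow> fm \<Rightarrow> bool" where
  "holds M w A \<longleftrightarrow> (\<forall>e. (\<forall>x. e x \<in> domain M) \<longrightarrow> sat M w e A)"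

text \<open>
  The first argument records the type \<open>'d\<close> from which the domains of models are drawn.  Since
  consequence quantifies over models with worlds in \<open>'w\<close> and domains in \<open>'d\<close> only, the failure of
  a consequence here is witnessed by a model, and so entails its failure over all models.  The types
  must not be too small: a one-element \<open>'w\<close> only admits the classical frame, and a finite \<open>'d\<close> admits
  no model of \<open>RCF\<close> at all.
\<close>

definition entails :: "'d itself \<Rightarrow> 'w frame set \<Rightarrow> fm set \<Rightarrow> fm \<Rightarrow> bool" where
  "entails (_ :: 'd itself) L T A \<longleftrightarrow>
    (\<forall>M :: ('w, 'd) model. L_model L M \<longrightarrow>
      (\<forall>C\<in>T. holds M (base (frame_of M)) C) \<longrightarrow> holds M (base (frame_of M)) A)"


section \<open>The axioms of real closed fields\<close>

primrec All_list :: "nat list \<Rightarrow> fm \<Rightarrow> fm" where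
  "All_list [] A = A"
| "All_list (x # xs) A = All x (All_list xs A)"

text \<open>\<open>tm_pow t n\<close> is the product of \<open>n\<close> copies of \<open>t\<close>, without a leading \<open>1\<close> for positive \<open>n\<close>.\<close>

fun tm_pow :: "tm \<Rightarrow> nat \<Rightarrow> tm" where
  "tm_pow t 0 = One"
| "tm_pow t (Suc 0) = t"
| "tm_pow t (Suc (Suc n)) = Times (tm_pow t (Suc n)) t"

text \<open>
  With \<open>y\<close> as variable \<open>0\<close> and \<open>x\<^sub>i\<close> as variable \<open>i\<close>, the term \<open>monic n k\<close> is
  \<open>y\<^sup>n + x\<^sub>1 y\<^sup>n\<^sup>-\<^sup>1 + \<dots> + x\<^sub>k y\<^sup>n\<^sup>-\<^sup>k\<close>, associated to the left, the last summand for \<open>k = n\<close> being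
  just \<open>x\<^sub>n\<close>.
\<close>

primrec monic :: "nat \<Rightarrow> nat \<Rightarrow> tm" where
  "monic n 0 = tm_pow (Var 0) n"
| "monic n (Suc k) = Plus (monic n k)
    (if Suc k = n then Var n else Times (Var (Suc k)) (tm_pow (Var 0) (n - Suc k)))"

definition odd_root_axiom :: "nat \<Rightarrow> fm" where
  "odd_root_axiom n = All_list [1..<Suc n] (Ex 0 (Eq (monic n n) Zero))"

definition RCF :: "fm set" where
  "RCF =
    (let x = Var 0; y = Var 1; z = Var 2 in
     {All_list [0] (Imp (Less x x) Bot),
      All_list [0, 1] (Or (Eq x y) (Or (Less x y) (Less y x))),
      All_list [0, 1, 2] (Imp (And (Less x y) (Less y z)) (Less x z)),
      All_list [0, 1] (Imp (And (Less Zero x) (Less Zero y)) (Less Zero (Times x y))),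
      All_list [0, 1, 2] (Imp (Less x y) (Less (Plus x z) (Plus y z))),
      All_list [0] (Ex 1 (Imp (Less Zero x) (Eq x (Times y y)))),
      All_list [0, 1, 2] (Eq (Plus (Plus x y) z) (Plus x (Plus y z))),
      All_list [0] (Eq (Plus x Zero) x),
      All_list [0] (Eq (Plus x (Neg x)) Zero),
      All_list [0, 1] (Eq (Plus x y) (Plus y x)),
      All_list [0, 1, 2] (Eq (Times (Times x y) z) (Times x (Times y z))),
      All_list [0] (Eq (Times x One) x),
      All_list [0] (Imp (Not (Eq x Zero)) (Eq (Times x (Inv x)) One)),
      All_list [0, 1] (Eq (Times x y) (Times y x)),
      All_list [0, 1, 2] (Eq (Times x (Plus y z)) (Plus (Times x y) (Times x z))),
      Imp (Eq Zero One) Bot}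
     \<union> {odd_root_axiom n | n. odd n})"

end

theory Submission
  imports Defs "HOL-Computational_Algebra.Polynomial" "HOL-Library.Countable_Set"
begin

text \<open>
  There is an \<open>RM\<close>-frame with just two worlds, \<open>u\<close> (the base world) and its star \<open>v\<close>, whose only
  missing triple is \<open>(u, u, v)\<close>: it is the frame of the three-valued logic \<open>RM3\<close>.  Let \<open>u\<close> interpret
  \<open>x < y\<close> by the usual order of a real closed field and let \<open>v\<close> interpret it as \<open>y - x \<in> C\<close>.  The
  valuation may only grow from \<open>v\<close> to \<open>u\<close>, so the elements of \<open>C\<close> must be positive.  The only axiom
  of \<open>RCF\<close> that asserts a positive fact about \<open><\<close> outright is totality, and an axiom has to hold at
  \<open>u\<close> only.  The others in which \<open><\<close> occurs are implications, which also speak about \<open>v\<close>; for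
  them it suffices that \<open>C\<close> is also closed under sums and products (\<open>two_world_model_RCF\<close>).

  This leaves much freedom in the choice of \<open>C\<close>: it may be empty, and it may be nonempty and yet
  contain no rational number, as the set of all \<open>a + b \<surd>2\<close> with \<open>a\<close> and \<open>b\<close> rational,
  \<open>b > 0\<close> and \<open>a - b \<surd>2 > 0\<close> (\<open>irrational_cone\<close>).  At \<open>v\<close> the sentence \<open>\<exists>x. 0 < x\<close> says that
  \<open>C\<close> is nonempty, and so it separates the two models.  A quantifier-free formula does not:
  when all its variables are assigned \<open>0\<close>, its terms denote rational numbers, and on these the two
  models agree at both worlds (\<open>qfree_sat_depends_on_rationals\<close>).  But a biconditional that is true
  at \<open>u\<close> forces both its sides to have the same truth value at \<open>v\<close>, since \<open>(u, v, v)\<close> is in the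
  relation.

  For the domain to fit into an arbitrary infinite type, the real closed field must be countable.
  It is obtained by closing the empty set of reals under the field operations and under the choice
  of one root for every polynomial that has a root (\<open>root_closure\<close>).
\<close>


section \<open>A countable real closed field\<close>

text \<open>
  Naming the elements of the closure by syntactic objects makes it countable at once.  Square roots
  need no name of their own, being roots of \<open>y\<^sup>2 - x\<close>.
\<close>

datatype code =
    CZero
  | COne
  | CNeg code
  | CInv code
  | CPlus code code
  | CTimes code code
  | CRoot "code list"

instance code :: countable
  by countable_datatype

primrec decode :: "code \<Rightarrow> real" where
  "decode CZero = 0"
| "decode COne = 1"
| "decode (CNeg c) = - decode c"
| "decode (CInv c) = inverse (decode c)"
| "decode (CPlus c d) = decode c + decode d"
| "decode (CTimes c d) = decode c * decode d"
| "decode (CRoot cs) = (SOME y. poly (Poly (map decode cs)) y = 0)"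

definition root_closure :: "real set" where
  "root_closure = range decode"

lemma countable_root_closure: "countable root_closure"
  by (simp add: root_closure_def)

lemma root_closure_field [simp, intro]:
  shows "0 \<in> root_closure" and "1 \<in> root_closure"
    and "x \<in> root_closure \<Longrightarrow> - x \<in> root_closure"
    and "x \<in> root_closure \<Longrightarrow> inverse x \<in> root_closure"
    and "x \<in> root_closure \<Longrightarrow> y \<in> root_closure \<Longrightarrow> x + y \<in> root_closure"
    and "x \<in> root_closure \<Longrightarrow> y \<in> root_closure \<Longrightarrow> x * y \<in> root_closure"
  unfolding root_closure_def
  by (auto intro: range_eqI[of _ decode CZero] range_eqI[of _ decode COne] range_eqI[of _ decode "CNeg _"]
      range_eqI[of _ decode "CInv _"] range_eqI[of _ decode "CPlus _ _"]
      range_eqI[of _ decode "CTimes _ _"])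

lemma root_closure_has_root:
  assumes "\<And>i. coeff p i \<in> root_closure" and "poly p x = 0"
  shows "\<exists>y\<in>root_closure. poly p y = 0"
proof -
  have "set (coeffs p) \<subseteq> range decode"
    using assms(1) by (auto simp: coeffs_def root_closure_def)
  then obtain cs where "coeffs p = map decode cs"
    by (metis ex_map_conv subset_iff rangeE)
  then have "decode (CRoot cs) = (SOME y. poly p y = 0)"
    by (metis Poly_coeffs decode.simps(7))
  moreover have "poly p (SOME y. poly p y = 0) = 0"
    using assms(2) by (rule someI)
  ultimately show ?thesis
    unfolding root_closure_def by (metis rangeI)
qed

lemma root_closure_square_root:
  assumes "x \<in> root_closure" "0 < x"
  shows "\<exists>y\<in>root_closure. x = y * y"
proof -
  have "\<exists>y\<in>root_closure. poly [:- x, 0, 1:] y = 0"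
    by (rule root_closure_has_root[where x = "sqrt x"])
      (use assms in \<open>auto simp: coeff_pCons split: nat.split\<close>)
  then show ?thesis by (auto simp: algebra_simps)
qed

lemma odd_monic_poly_has_root:
  fixes p :: "real poly"
  assumes "odd (degree p)" and "lead_coeff p = 1"
  shows "\<exists>x. poly p x = 0"
proof -
  obtain b where b: "\<And>x. b \<le> x \<Longrightarrow> poly p x \<ge> 1"
    using poly_pinfty_gt_lc[of p] assms(2) by auto
  \<comment> \<open>Reflecting \<open>p\<close> and changing its sign gives a monic polynomial again, the degree being odd.\<close>
  define q where "q = - pcompose p [:0, -1:]"
  have "degree q = degree p"
    by (simp add: q_def degree_pcompose)
  moreover have "lead_coeff q = 1"
    unfolding q_def lead_coeff_minus using assms by (subst lead_coeff_comp) simp_all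
  ultimately obtain c where c: "\<And>x. c \<le> x \<Longrightarrow> poly q x \<ge> 1"
    using poly_pinfty_gt_lc[of q] by auto
  define d where "d = max 1 (max b c)"
  have d: "0 < d" "b \<le> d" "c \<le> d"
    by (simp_all add: d_def)
  have "poly p d > 0"
    using b[OF d(2)] by linarith
  moreover have "poly p (- d) < 0"
    using c[OF d(3)] by (simp add: q_def poly_pcompose)
  ultimately show ?thesis
    using poly_IVT_pos[of "- d" d p] d(1) by auto
qed


section \<open>The two-world model\<close>

definition RM3_frame :: "'w \<Rightarrow> 'w \<Rightarrow> 'w frame" where
  "RM3_frame u v =
    \<lparr>worlds = {u, v}, rel = {u, v} \<times> {u, v} \<times> {u, v} - {(u, u, v)},
     star = (\<lambda>w. if w = u then v else u), base = u\<rparr>"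

lemma RM_frame_RM3_frame:
  assumes "u \<noteq> v"
  shows "RM_frame (RM3_frame u v)"
  using assms unfolding RM_frame_def B_frame_def RM3_frame_def Let_def by auto

text \<open>The field is carried over to the domain \<open>f ` root_closure\<close> by a map \<open>f\<close> that is injective on it.\<close>

definition two_world_model ::
  "'w \<Rightarrow> 'w \<Rightarrow> (real \<Rightarrow> 'd) \<Rightarrow> real set \<Rightarrow> ('w, 'd) model" where
  "two_world_model u v f C =
    (let g = inv_into root_closure f in
     \<lparr>frame_of = RM3_frame u v, domain = f ` root_closure,
      zero_of = f 0, one_of = f 1, neg_of = (\<lambda>x. f (- g x)), inv_of = (\<lambda>x. f (inverse (g x))),
      plus_of = (\<lambda>x y. f (g x + g y)), times_of = (\<lambda>x y. f (g x * g y)),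
      less_at = (\<lambda>w. {(f x, f y) | x y. x \<in> root_closure \<and> y \<in> root_closure \<and>
                         (if w = u then x < y else y - x \<in> C)})\<rparr>)"

definition positive_cone :: "real set \<Rightarrow> bool" where
  "positive_cone C \<longleftrightarrow>
    (\<forall>x\<in>C. 0 < x) \<and> (\<forall>x\<in>C. \<forall>y\<in>C. x + y \<in> C) \<and> (\<forall>x\<in>C. \<forall>y\<in>C. x * y \<in> C)"

primrec real_val :: "(nat \<Rightarrow> real) \<Rightarrow> tm \<Rightarrow> real" where
  "real_val r (Var x) = r x"
| "real_val r Zero = 0"
| "real_val r One = 1"
| "real_val r (Neg t) = - real_val r t"
| "real_val r (Inv t) = inverse (real_val r t)"
| "real_val r (Plus t u) = real_val r t + real_val r u"
| "real_val r (Times t u) = real_val r t * real_val r u"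

lemma real_val_closed:
  assumes "\<And>x. r x \<in> root_closure"
  shows "real_val r t \<in> root_closure"
  using assms by (induction t) auto

lemma real_val_rational:
  assumes "\<And>x. r x \<in> \<rat>"
  shows "real_val r t \<in> \<rat>"
  using assms by (induction t) auto

lemma two_world_model_sel [simp]:
  "frame_of (two_world_model u v f C) = RM3_frame u v"
  "domain (two_world_model u v f C) = f ` root_closure"
  by (simp_all add: two_world_model_def Let_def)

lemma RM3_frame_sel [simp]:
  "base (RM3_frame u v) = u"
  "star (RM3_frame u v) w = (if w = u then v else u)"
  by (simp_all add: RM3_frame_def)

lemma tm_val_two_world_model:
  assumes "inj_on f root_closure" and "\<And>x. r x \<in> root_closure"
  shows "tm_val (two_world_model u v f C) (f \<circ> r) t = f (real_val r t)"
proof (induction t)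
qed (use real_val_closed[OF assms(2)] assms(1) in
    \<open>simp_all add: two_world_model_def Let_def\<close>)

lemma sat_Eq_two_world_model:
  assumes "inj_on f root_closure" and "\<And>x. r x \<in> root_closure"
  shows "sat (two_world_model u v f C) w (f \<circ> r) (Eq t t') \<longleftrightarrow> real_val r t = real_val r t'"
  using real_val_closed[OF assms(2)] assms(1)
  by (simp add: tm_val_two_world_model[OF assms] inj_on_eq_iff)

lemma sat_Less_two_world_model:
  assumes "inj_on f root_closure" and "\<And>x. r x \<in> root_closure"
  shows "sat (two_world_model u v f C) w (f \<circ> r) (Less t t') \<longleftrightarrow>
    (if w = u then real_val r t < real_val r t' else real_val r t' - real_val r t \<in> C)"
proof -
  have "(f a, f b) \<in> less_at (two_world_model u v f C) w \<longleftrightarrow> (if w = u then a < b else b - a \<in> C)"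
    if "a \<in> root_closure" "b \<in> root_closure" for a b
    using that assms(1) by (auto simp: two_world_model_def Let_def inj_on_eq_iff)
  then show ?thesis
    using real_val_closed[OF assms(2)] by (simp add: tm_val_two_world_model[OF assms])
qed

lemma sat_Ex_two_world_model:
  "sat (two_world_model u v f C) w (f \<circ> r) (Ex x A) \<longleftrightarrow>
    (\<exists>y\<in>root_closure. sat (two_world_model u v f C) w (f \<circ> r(x := y)) A)"
  by (simp add: fun_upd_comp)

text \<open>
  The three conjuncts come from the triples \<open>(u, u, u)\<close>, \<open>(u, v, v)\<close> and \<open>(u, v, u)\<close> of the frame.
\<close>

lemma sat_Imp_base_two_world_model:
  assumes "u \<noteq> v"
  shows "sat (two_world_model u v f C) u e (Imp A B) \<longleftrightarrow>
    (let S = sat (two_world_model u v f C) in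
      (S u e A \<longrightarrow> S u e B) \<and> (S v e A \<longrightarrow> S v e B) \<and> (S v e A \<longrightarrow> S u e B))"
  using assms by (auto simp: RM3_frame_def Let_def)

lemma B_model_two_world_model:
  assumes "u \<noteq> v" and "positive_cone C"
  shows "B_model (two_world_model u v f C)"
proof -
  have "B_frame (RM3_frame u v)"
    using RM_frame_RM3_frame[OF assms(1)] by (simp add: RM_frame_def)
  moreover have "less_at (two_world_model u v f C) a \<subseteq> less_at (two_world_model u v f C) b"
    if "(u, a, b) \<in> rel (RM3_frame u v)" for a b
  proof -
    have "a = b \<or> a = v \<and> b = u"
      using that by (auto simp: RM3_frame_def)
    then show ?thesis
      using assms unfolding two_world_model_def positive_cone_def Let_def
      by (fastforce split: if_splits)
  qed
  moreover have "less_at (two_world_model u v f C) a \<subseteq> f ` root_closure \<times> f ` root_closure" for a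
    by (auto simp: two_world_model_def Let_def)
  moreover have "inv_into root_closure f x \<in> root_closure" if "x \<in> f ` root_closure" for x
    using that by (rule inv_into_into)
  ultimately show ?thesis
    unfolding B_model_def by (simp add: Let_def) (auto simp: two_world_model_def Let_def)
qed


section \<open>The axioms hold in the two-world model\<close>

lemma holds_All_list:
  assumes "holds M w A"
  shows "holds M w (All_list xs A)"
  using assms by (induction xs) (auto simp: holds_def)

lemma holds_two_world_modelI:
  assumes "\<And>r. (\<And>x. r x \<in> root_closure) \<Longrightarrow> sat (two_world_model u v f C) w (f \<circ> r) A"
  shows "holds (two_world_model u v (f :: real \<Rightarrow> 'b) C) w A"
  unfolding holds_def
proof (intro allI impI)
  fix e :: "nat \<Rightarrow> 'b" assume e: "\<forall>x. e x \<in> domain (two_world_model u v f C)"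
  let ?r = "inv_into root_closure f \<circ> e"
  have "f \<circ> ?r = e"
    using e by (auto simp: fun_eq_iff f_inv_into_f)
  moreover have "?r x \<in> root_closure" for x
    using e by (simp add: inv_into_into)
  ultimately show "sat (two_world_model u v f C) w e A"
    using assms[of ?r] by simp
qed

text \<open>The polynomial in the variable \<open>0\<close> that \<open>monic n k\<close> is when \<open>r\<close> interprets the others.\<close>

primrec monic_poly :: "(nat \<Rightarrow> real) \<Rightarrow> nat \<Rightarrow> nat \<Rightarrow> real poly" where
  "monic_poly r n 0 = monom 1 n"
| "monic_poly r n (Suc k) = monic_poly r n k + monom (r (Suc k)) (n - Suc k)"

lemma real_val_tm_pow: "real_val r (tm_pow t n) = real_val r t ^ n"
  by (induction t n rule: tm_pow.induct) auto

lemma real_val_monic: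
  "k \<le> n \<Longrightarrow> real_val (r(0 := y)) (monic n k) = poly (monic_poly r n k) y"
  by (induction k) (auto simp: real_val_tm_pow poly_monom)

lemma coeff_monic_poly_closed:
  assumes "\<And>x. r x \<in> root_closure"
  shows "coeff (monic_poly r n k) i \<in> root_closure"
  using assms by (induction k) auto

lemma degree_monic_poly:
  "k \<le> n \<Longrightarrow> degree (monic_poly r n k) = n \<and> coeff (monic_poly r n k) n = 1"
proof (induction k)
  case 0
  show ?case by (simp add: degree_monom_eq)
next
  case (Suc k)
  have "degree (monom (r (Suc k)) (n - Suc k)) < n"
    using Suc.prems by (intro le_less_trans[OF degree_monom_le]) simp
  then show ?case
    using Suc by (auto simp: degree_add_eq_left coeff_eq_0)
qed

lemma odd_root_axiom_two_world_model:
  assumes "inj_on f root_closure" and "odd n"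
  shows "holds (two_world_model u v f C) u (odd_root_axiom n)"
  unfolding odd_root_axiom_def
proof (intro holds_All_list holds_two_world_modelI)
  fix r :: "nat \<Rightarrow> real" assume r: "\<And>x. r x \<in> root_closure"
  have "\<exists>x. poly (monic_poly r n n) x = 0"
    using degree_monic_poly[of n n r] assms(2) by (simp add: odd_monic_poly_has_root)
  then obtain y where "y \<in> root_closure" "poly (monic_poly r n n) y = 0"
    using root_closure_has_root[OF coeff_monic_poly_closed[of r n n, OF r]] by auto
  then show "sat (two_world_model u v f C) u (f \<circ> r) (Ex 0 (Eq (monic n n) Zero))"
    unfolding sat_Ex_two_world_model
    by (intro bexI[of _ y]) (simp_all add: sat_Eq_two_world_model assms(1) r real_val_monic
      del: sat.simps)
qed

text \<open>
  For an implication the triple \<open>(u, u, u)\<close> asks for the usual law of ordered fields, and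
  \<open>(u, v, v)\<close> for the same law of the relation \<open>y - x \<in> C\<close>.  That relation is invariant under
  translations whatever \<open>C\<close> is; it is transitive because \<open>C\<close> is closed under sums, and positive
  elements have positive products because \<open>C\<close> is closed under products.  The triple \<open>(u, v, u)\<close>
  adds nothing new, since \<open>y - x \<in> C\<close> implies \<open>x < y\<close>.
\<close>

lemma two_world_model_RCF:
  assumes "u \<noteq> v" and inj: "inj_on f root_closure" and "positive_cone C" and "A \<in> RCF"
  shows "holds (two_world_model u v f C) u A"
proof -
  have pos: "0 < x" if "x \<in> C" for x
    using assms(3) that by (simp add: positive_cone_def)
  have cone_less: "x < y" if "y - x \<in> C" for x y
    using pos[OF that] by simp
  have no_zero: "0 \<notin> C"
    using pos by blast
  have add: "x + y \<in> C" and mult: "x * y \<in> C" if "x \<in> C" "y \<in> C" for x y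
    using assms(3) that by (simp_all add: positive_cone_def)
  have trans: "z - x \<in> C" if "y - x \<in> C" "z - y \<in> C" for x y z
    using add[OF that] by simp
  have square: "\<exists>y\<in>root_closure. (0 < x \<longrightarrow> x = y * y) \<and> (x \<in> C \<longrightarrow> x = y * y)"
    if "x \<in> root_closure" for x
    using root_closure_square_root[OF that] pos[of x]
    by (cases "0 < x") (blast, metis root_closure_field(1))
  note sat = sat_Eq_two_world_model[OF inj] sat_Less_two_world_model[OF inj]
    sat_Imp_base_two_world_model[OF \<open>u \<noteq> v\<close>] sat_Ex_two_world_model
  have odd: "\<forall>A\<in>{odd_root_axiom n | n. odd n}. holds (two_world_model u v f C) u A"
    by (auto intro: odd_root_axiom_two_world_model[OF inj])
  have "\<forall>A\<in>RCF. holds (two_world_model u v f C) u A"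
    unfolding RCF_def Let_def ball_Un
    by (intro conjI odd, simp only: ball_simps simp_thms,
        intro conjI holds_All_list holds_two_world_modelI)
       (auto simp: sat \<open>u \<noteq> v\<close>[symmetric] square pos mult no_zero algebra_simps
          simp del: sat.simps(1,2,8,9,10) intro: cone_less cone_less[OF trans] trans)
  then show ?thesis using assms(4) by blast
qed


section \<open>A cone without rational elements\<close>

text \<open>
  A cone with one generator \<open>t\<close> consists of the values at \<open>t\<close> of nonzero polynomials with natural
  coefficients and without constant term.  For \<open>t = sqrt 2\<close> it contains \<open>t * t = 2\<close>.  For
  \<open>t = 2 + sqrt 2\<close>, whose conjugate \<open>2 - sqrt 2\<close> is positive as well, it contains no rational
  number: such a polynomial is strictly increasing on the positive reals, so it takes different
  values at \<open>t\<close> and at its conjugate, whereas a rational value would be its own conjugate.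
  The following cone contains that one and is easier to describe.
\<close>

definition irrational_cone :: "real set" where
  "irrational_cone = {a + b * sqrt 2 | a b. a \<in> \<rat> \<and> b \<in> \<rat> \<and> 0 < b \<and> b * sqrt 2 < a}"

lemma sqrt_2_irrational: "sqrt 2 \<notin> \<rat>"
proof
  assume "sqrt 2 \<in> \<rat>"
  moreover have "algebraic_int (sqrt 2)" by (intro algebraic_int_sqrt) auto
  ultimately have "sqrt 2 \<in> \<int>" by (intro rational_algebraic_int_is_int)
  then obtain k :: int where "sqrt 2 = of_int k" by (elim Ints_cases)
  moreover have "1 < sqrt 2" "sqrt 2 < 2" by (simp_all add: real_less_lsqrt)
  ultimately show False by simp
qed

lemma irrational_cone_irrational: "irrational_cone \<inter> \<rat> = {}"
proof -
  have "a + b * sqrt 2 \<notin> \<rat>" if "a \<in> \<rat>" "b \<in> \<rat>" "0 < b" for a b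
  proof
    assume "a + b * sqrt 2 \<in> \<rat>"
    then have "(a + b * sqrt 2 - a) / b \<in> \<rat>" using that by (intro Rats_divide Rats_diff)
    then show False using that sqrt_2_irrational by simp
  qed
  then show ?thesis by (auto simp: irrational_cone_def)
qed

text \<open>
  The condition \<open>b * sqrt 2 < a\<close> says that the conjugate \<open>a - b * sqrt 2\<close> is positive.  It makes
  \<open>a\<close> positive, and therefore the coefficient \<open>a * b' + a' * b\<close> of \<open>sqrt 2\<close> in a product too.
\<close>

lemma positive_cone_irrational_cone: "positive_cone irrational_cone"
  unfolding positive_cone_def
proof (intro conjI ballI)
  fix x assume "x \<in> irrational_cone"
  then obtain a b where x: "x = a + b * sqrt 2" "a \<in> \<rat>" "b \<in> \<rat>" "0 < b" "b * sqrt 2 < a"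
    by (auto simp: irrational_cone_def)
  then have b: "0 < b * sqrt 2" by simp
  then show "0 < x" using x by linarith
  fix y assume "y \<in> irrational_cone"
  then obtain c d where y: "y = c + d * sqrt 2" "c \<in> \<rat>" "d \<in> \<rat>" "0 < d" "d * sqrt 2 < c"
    by (auto simp: irrational_cone_def)
  then have d: "0 < d * sqrt 2" by simp
  have "x + y = (a + c) + (b + d) * sqrt 2" "(b + d) * sqrt 2 < a + c"
    using x y by (auto simp: algebra_simps)
  then show "x + y \<in> irrational_cone"
    unfolding irrational_cone_def using x y by fastforce
  have "0 < a" "0 < c" using x y b d by linarith+
  then have "0 < a * d + c * b" using x y by (simp add: add_pos_pos)
  moreover have "x * y = (a * c + 2 * b * d) + (a * d + c * b) * sqrt 2"
    using x y by (simp add: algebra_simps)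
  moreover have "0 < (a - b * sqrt 2) * (c - d * sqrt 2)" using x y by simp
  then have "(a * d + c * b) * sqrt 2 < a * c + 2 * b * d"
    by (simp add: algebra_simps)
  moreover have "a * c + 2 * b * d \<in> \<rat>" "a * d + c * b \<in> \<rat>"
    using x y by auto
  ultimately show "x * y \<in> irrational_cone"
    unfolding irrational_cone_def by blast
qed

lemma irrational_cone_meets_root_closure: "\<exists>x\<in>root_closure. x \<in> irrational_cone"
proof -
  have two: "2 \<in> root_closure"
    using root_closure_field(5)[of 1 1] by simp
  then obtain y where y: "y \<in> root_closure" "2 = y * y"
    using root_closure_square_root[of 2] by auto
  then have "sqrt 2 = y \<or> sqrt 2 = - y"
    by (metis abs_real_def real_sqrt_abs2)
  then have "sqrt 2 \<in> root_closure"
    using y(1) by (metis root_closure_field(3))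
  then have "2 + sqrt 2 \<in> root_closure"
    using two by blast
  moreover have "2 + sqrt 2 \<in> irrational_cone"
    unfolding irrational_cone_def
    by (intro CollectI exI[of _ 2] exI[of _ 1]) (simp add: real_less_lsqrt)
  ultimately show ?thesis by blast
qed


section \<open>Failure of quantifier elimination\<close>

text \<open>
  With every variable assigned \<open>0\<close>, terms have rational values, so the formula can see no more of
  the cone than its rational elements.  There is no such bound for a quantifier, which ranges over
  the whole domain.
\<close>

lemma qfree_sat_depends_on_rationals:
  assumes inj: "inj_on f root_closure" and C: "C \<inter> \<rat> = C' \<inter> \<rat>" and "qfree B"
  shows "sat (two_world_model u v f C) w (f \<circ> (\<lambda>_. 0)) B \<longleftrightarrow>
    sat (two_world_model u v f C') w (f \<circ> (\<lambda>_. 0)) B"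
  using \<open>qfree B\<close>
proof (induction B arbitrary: w)
  case (Eq t t')
  show ?case by (simp only: sat_Eq_two_world_model[OF inj] root_closure_field)
next
  case (Less t t')
  have "real_val (\<lambda>_. 0) t' - real_val (\<lambda>_. 0) t \<in> \<rat>"
    by (simp add: real_val_rational)
  then have "real_val (\<lambda>_. 0) t' - real_val (\<lambda>_. 0) t \<in> C \<longleftrightarrow>
      real_val (\<lambda>_. 0) t' - real_val (\<lambda>_. 0) t \<in> C'"
    using C by blast
  then show ?case
    by (simp only: sat_Less_two_world_model[OF inj] root_closure_field)
qed simp_all

lemma sat_Ex_positive_iff_cone_nonempty:
  assumes "u \<noteq> v" and "inj_on f root_closure" and "\<And>x. r x \<in> root_closure"
  shows "sat (two_world_model u v f C) v (f \<circ> r) (Ex 0 (Less Zero (Var 0))) \<longleftrightarrow>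
    (\<exists>x\<in>root_closure. x \<in> C)"
  unfolding sat_Ex_two_world_model
  using assms by (simp add: sat_Less_two_world_model del: sat.simps)

theorem theorem8:
  fixes L :: "'w frame set"
  assumes "\<exists>u v :: 'w. u \<noteq> v"
    and "infinite (UNIV :: 'd set)"
    and "logic_between_B_and_RM L"
  shows "\<exists>A. \<not> (\<exists>B. qfree B \<and> entails TYPE('d) L RCF (Iff A B))"
proof (intro exI notI)
  let ?A = "Ex 0 (Less Zero (Var 0))"
  assume "\<exists>B. qfree B \<and> entails TYPE('d) L RCF (Iff ?A B)"
  then obtain B where B: "qfree B" "entails TYPE('d) L RCF (Iff ?A B)" by blast
  obtain u v :: 'w where uv: "u \<noteq> v" using assms(1) by blast
  obtain h :: "nat \<Rightarrow> 'd" where "inj h"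
    using infinite_countable_subset[OF assms(2)] by blast
  then have inj: "inj_on (h \<circ> to_nat_on root_closure) root_closure" (is "inj_on ?f _")
    using countable_root_closure by (intro comp_inj_on) (auto intro: inj_on_subset)
  let ?M = "two_world_model u v ?f" and ?e = "?f \<circ> (\<lambda>_. 0)"
  have A_iff_B: "sat (?M C) v ?e ?A \<longleftrightarrow> sat (?M C) v ?e B" if C: "positive_cone C" for C
  proof -
    have "RM3_frame u v \<in> L"
      using assms(3) RM_frame_RM3_frame[OF uv] by (simp add: logic_between_B_and_RM_def)
    then have "L_model L (?M C)"
      using B_model_two_world_model[OF uv C] by (simp add: L_model_def)
    then have "holds (?M C) u (Iff ?A B)"
      using B(2) two_world_model_RCF[OF uv inj C] by (auto simp: entails_def)
    then have "sat (?M C) u ?e (Iff ?A B)"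
      by (simp add: holds_def del: sat.simps)
    then show ?thesis
      unfolding Iff_def sat.simps(6) sat_Imp_base_two_world_model[OF uv] Let_def by blast
  qed
  have "sat (?M irrational_cone) v ?e ?A"
    using sat_Ex_positive_iff_cone_nonempty[OF uv inj] irrational_cone_meets_root_closure
    by (simp del: sat.simps)
  then have "sat (?M irrational_cone) v ?e B"
    using A_iff_B positive_cone_irrational_cone by blast
  then have "sat (?M {}) v ?e B"
    using qfree_sat_depends_on_rationals[OF inj _ B(1)] irrational_cone_irrational
    by (metis Int_empty_left)
  then have "sat (?M {}) v ?e ?A"
    using A_iff_B[of "{}"] by (simp add: positive_cone_def del: sat.simps)
  then show False
    using sat_Ex_positive_iff_cone_nonempty[OF uv inj] by (simp del: sat.simps)
qed

end
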